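(* Let $\mathbb{X}\subset\mathbb{R}^{N_1}$ be closed and bounded. The two-layer neural network with ReLU activation functions is a universal approximator. That is, for $J\ge1$ let $\mathcal{F}_J$ be the class of functions $x\mapsto\sum_{j=1}^Jw_j\max\{u_j^\top x+u_{0j},0\}+w_0$ on $\mathbb{X}$ with $u_j\in\mathbb{R}^{N_1}$ and $u_{0j},w_j,w_0\in\mathbb{R}$; then for every $L_v<\infty$ and $1\le p\le\infty$, $$\lim_{J\to\infty}\mathcal{E}_p(\mathrm{Lip}(L_v),\mathcal{F}_J)=0.$$
   Context: $\mathrm{Lip}(L_v)$ is the class of functions $v:\mathbb{X}\to\mathbb{R}$ with $|v(x)-v(x')|\le L_v\|x-x'\|$ for all $x,x'\in\mathbb{X}$. For a function class $\mathcal{F}$ on $\mathbb{X}$, the inherent Bellman error is $\mathcal{E}_p(\mathrm{Lip}(L_v),\mathcal{F})=\sup_{g\in\mathrm{Lip}(L_v)}\inf_{f\in\mathcal{F}}\|g-f\|_p$, $1\le p\le\infty$, where $\|\cdot\|_p$ for $p<\infty$ is the $L_p$ norm with respect to the sampling probability distribution $\mu$ on $\mathbb{X}$ and $\|\cdot\|_\infty$ is the supremum norm on $\mathbb{X}$. A sequence of classes $\{\mathcal{F}_i\}_{i\ge1}$ is called universal if $\lim_{i\to\infty}\mathcal{E}_p(\mathrm{Lip}(L_v),\mathcal{F}_i)=0$. *)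

theory Defs
  imports "HOL-Probability.Probability"
begin

text \<open>
  A function on a set \<open>X\<close> is represented by a total function of which only the values on \<open>X\<close>
  matter: membership in the classes below, and all norms (the measure \<open>\<mu>\<close> has space \<open>X\<close>),
  are insensitive to values outside \<open>X\<close>.
\<close>

definition Lip :: "(real ^ 'n) set \<Rightarrow> real \<Rightarrow> (real ^ 'n \<Rightarrow> real) set" where
  "Lip X L = {v. \<forall>x\<in>X. \<forall>x'\<in>X. \<bar>v x - v x'\<bar> \<le> L * norm (x - x')}"

lemma Lip_eq_lipschitz_on:
  assumes "0 \<le> L"
  shows "Lip X L = {v. L-lipschitz_on X v}"
  using assms by (auto simp: Lip_def lipschitz_on_def dist_norm)

text \<open>
  Norms take values in the extended nonnegative reals, so that they, and the suprema and infima
  below, need no finiteness side conditions. An infinite integral gives an infinite norm.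
  The case \<open>p = \<infinity>\<close> is the plain supremum over \<open>X\<close>, not the essential supremum.
\<close>

definition Lp_norm ::
  "(real ^ 'n) set \<Rightarrow> (real ^ 'n) measure \<Rightarrow> ennreal \<Rightarrow> (real ^ 'n \<Rightarrow> real) \<Rightarrow> ennreal" where
  "Lp_norm X \<mu> p h =
     (if p = \<infinity> then (SUP x\<in>X. ennreal \<bar>h x\<bar>)
      else let I = (\<integral>\<^sup>+ x. ennreal (\<bar>h x\<bar> powr enn2real p) \<partial>\<mu>)
           in if I = \<infinity> then \<infinity> else ennreal (enn2real I powr (1 / enn2real p)))"

definition inherent_bellman_error ::
  "(real ^ 'n) set \<Rightarrow> (real ^ 'n) measure \<Rightarrow> ennreal \<Rightarrow>
   (real ^ 'n \<Rightarrow> real) set \<Rightarrow> (real ^ 'n \<Rightarrow> real) set \<Rightarrow> ennreal" where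
  "inherent_bellman_error X \<mu> p G F = (SUP g\<in>G. INF f\<in>F. Lp_norm X \<mu> p (\<lambda>x. g x - f x))"

definition universal ::
  "(real ^ 'n) set \<Rightarrow> (real ^ 'n) measure \<Rightarrow> ennreal \<Rightarrow> real \<Rightarrow>
   (nat \<Rightarrow> (real ^ 'n \<Rightarrow> real) set) \<Rightarrow> bool" where
  "universal X \<mu> p L F \<longleftrightarrow> (\<lambda>i. inherent_bellman_error X \<mu> p (Lip X L) (F i)) \<longlonglongrightarrow> 0"

definition relu_networks :: "(real ^ 'n) set \<Rightarrow> nat \<Rightarrow> (real ^ 'n \<Rightarrow> real) set" where
  "relu_networks X J =
     {f. \<exists>(u :: nat \<Rightarrow> real ^ 'n) (u0 :: nat \<Rightarrow> real) (w :: nat \<Rightarrow> real) (w0 :: real).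
           \<forall>x\<in>X. f x = (\<Sum>j=1..J. w j * max (u j \<bullet> x + u0 j) 0) + w0}"

end

theory Submission imports Defs begin

text \<open>
  The exponentials \<open>x \<mapsto> exp (u \<bullet> x)\<close> span an algebra that separates points, so by Stone--Weierstrass
  they are uniformly dense in the continuous functions on the compact set \<open>X\<close>; each of them is a
  continuous function of the single variable \<open>u \<bullet> x\<close>, hence uniformly approximated by a sum of
  ramps, which are differences of two ReLU units. So every continuous function is approximated by
  networks. For uniformity over the Lipschitz class, take a finite \<open>\<delta>\<close>-net \<open>C\<close> of \<open>X\<close> with a
  subordinate partition of unity \<open>\<phi>\<^sub>c\<close>: every Lipschitz \<open>g\<close> is close to
  \<open>g a + (\<Sum>c\<in>C. (g c - g a) * \<phi>\<^sub>c)\<close>, whose coefficients are bounded by the Lipschitz constant times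
  the diameter, so replacing every \<open>\<phi>\<^sub>c\<close> by one fixed network serves all \<open>g\<close> at once with the same
  number of units.
\<close>

section \<open>ReLU networks as a vector space\<close>

lemma relu_networks_const: "(\<lambda>x. c) \<in> relu_networks X 0"
  by (auto simp: relu_networks_def)

lemma relu_networks_unit: "(\<lambda>x. max (u \<bullet> x + b) 0) \<in> relu_networks X 1"
  unfolding relu_networks_def
  by (intro CollectI exI[of _ "\<lambda>_. u"] exI[of _ "\<lambda>_. b"] exI[of _ "\<lambda>_. 1"] exI[of _ 0]) simp

lemma relu_networks_scale:
  assumes "f \<in> relu_networks X J"
  shows "(\<lambda>x. c * f x) \<in> relu_networks X J"
proof -
  obtain u u0 w w0 where f: "\<And>x. x \<in> X \<Longrightarrow> f x = (\<Sum>j=1..J. w j * max (u j \<bullet> x + u0 j) 0) + w0"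
    using assms by (auto simp: relu_networks_def)
  show ?thesis
    unfolding relu_networks_def
    by (intro CollectI exI[of _ u] exI[of _ u0] exI[of _ "\<lambda>j. c * w j"] exI[of _ "c * w0"])
       (simp add: f sum_distrib_left algebra_simps)
qed

text \<open>Placing the two lists of hidden units side by side uses exactly \<open>J + K\<close>
  units. Those of \<open>g\<close> sit at the indices from \<open>J + 1\<close> on, hence the shift
  \<open>j - J\<close>.\<close>

lemma relu_networks_add:
  assumes "f \<in> relu_networks X J" "g \<in> relu_networks X K"
  shows "(\<lambda>x. f x + g x) \<in> relu_networks X (J + K)"
proof -
  obtain u u0 w w0 where f: "\<And>x. x \<in> X \<Longrightarrow> f x = (\<Sum>j=1..J. w j * max (u j \<bullet> x + u0 j) 0) + w0"
    using assms by (auto simp: relu_networks_def)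
  obtain v v0 z z0 where g: "\<And>x. x \<in> X \<Longrightarrow> g x = (\<Sum>j=1..K. z j * max (v j \<bullet> x + v0 j) 0) + z0"
    using assms by (auto simp: relu_networks_def)
  have "(\<Sum>j=1..J+K. (if j \<le> J then w j else z (j - J)) *
          max ((if j \<le> J then u j else v (j - J)) \<bullet> x + (if j \<le> J then u0 j else v0 (j - J))) 0) =
        (\<Sum>j=1..J. w j * max (u j \<bullet> x + u0 j) 0) + (\<Sum>j=1..K. z j * max (v j \<bullet> x + v0 j) 0)" for x
  proof -
    let ?h = "\<lambda>j. (if j \<le> J then w j else z (j - J)) *
          max ((if j \<le> J then u j else v (j - J)) \<bullet> x + (if j \<le> J then u0 j else v0 (j - J))) 0"
    have "{1..J+K} = {1..J} \<union> {1+J..K+J}" by auto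
    then have "sum ?h {1..J+K} = sum ?h {1..J} + sum ?h {1+J..K+J}"
      by (simp add: sum.union_disjoint)
    also have "sum ?h {1+J..K+J} = (\<Sum>j=1..K. ?h (j + J))"
      by (rule sum.shift_bounds_cl_nat_ivl)
    also have "\<dots> = (\<Sum>j=1..K. z j * max (v j \<bullet> x + v0 j) 0)"
      by (intro sum.cong) auto
    finally show ?thesis by simp
  qed
  then show ?thesis
    unfolding relu_networks_def
    by (intro CollectI exI[of _ "\<lambda>j. if j \<le> J then u j else v (j - J)"]
          exI[of _ "\<lambda>j. if j \<le> J then u0 j else v0 (j - J)"]
          exI[of _ "\<lambda>j. if j \<le> J then w j else z (j - J)"] exI[of _ "w0 + z0"])
       (simp add: f g)
qed

lemma relu_networks_mono:
  assumes "J \<le> K"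
  shows "relu_networks X J \<subseteq> relu_networks X K"
proof
  fix f assume f: "f \<in> relu_networks X J"
  have zero: "(\<lambda>x. 0) \<in> relu_networks X n" for n
    unfolding relu_networks_def
    by (intro CollectI exI[of _ "\<lambda>_. 0"] exI[of _ "\<lambda>_. 0"] exI[of _ 0]) simp
  show "f \<in> relu_networks X K"
    using relu_networks_add[OF f zero[of "K - J"]] assms by simp
qed

lemma relu_networks_sum:
  assumes "finite A" "\<And>a. a \<in> A \<Longrightarrow> f a \<in> relu_networks X (k a)"
  shows "(\<lambda>x. \<Sum>a\<in>A. c a * f a x) \<in> relu_networks X (sum k A)"
  using assms
proof (induction A rule: finite_induct)
  case empty
  show ?case using relu_networks_const[of 0 X] by simp
next
  case (insert a A)
  have "(\<lambda>x. c a * f a x + (\<Sum>a\<in>A. c a * f a x)) \<in> relu_networks X (k a + sum k A)"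
    using insert.IH insert.prems by (intro relu_networks_add relu_networks_scale) auto
  then show ?case using insert.hyps by simp
qed

section \<open>Uniform approximation of continuous functions\<close>

text \<open>Evaluates an interpolant at a point of grid cell \<open>m\<close>: ramps to the left are
  saturated and their increments telescope, ramps to the right vanish, and only ramp
  \<open>m\<close> may be fractional.\<close>

lemma sum_unit_steps:
  fixes h :: "nat \<Rightarrow> real"
  assumes "m < n" and "\<And>k. k < m \<Longrightarrow> r k = 1" and "\<And>k. m < k \<Longrightarrow> r k = 0"
  shows "(\<Sum>k<n. (h (Suc k) - h k) * r k) = h m - h 0 + (h (Suc m) - h m) * r m"
proof -
  have "(\<Sum>k<m. (h (Suc k) - h k) * r k) = (\<Sum>k<m. h (Suc k) - h k)"
    by (intro sum.cong) (simp_all add: assms(2))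
  then have below: "(\<Sum>k<m. (h (Suc k) - h k) * r k) = h m - h 0"
    by (simp add: sum_lessThan_telescope)
  show ?thesis
    using assms(1)
  proof (induction n)
    case (Suc n)
    then show ?case
      using below by (cases "m = n") (simp_all add: assms(3))
  qed simp
qed

text \<open>On \<open>X\<close> the argument \<open>u \<bullet> x\<close> stays in a compact
  interval, where \<open>h\<close> is uniformly continuous; so linear interpolation on a fine grid
  is accurate.\<close>

lemma relu_ridge_approx:
  fixes X :: "(real ^ 'n) set"
  assumes "bounded X" "continuous_on UNIV h" "0 < e"
  shows "\<exists>J. \<exists>f\<in>relu_networks X J. \<forall>x\<in>X. \<bar>h (u \<bullet> x) - f x\<bar> < e"
proof -
  obtain B where B: "\<And>x. x \<in> X \<Longrightarrow> norm x \<le> B" and "0 < B"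
    using assms(1) bounded_pos by blast
  \<comment> \<open>The added 1 makes \<open>\<bar>u \<bullet> x\<bar> < b\<close> strict, so the
    argument lies before the last node and its cell index stays below \<open>n\<close>.\<close>
  define b where "b = norm u * B + 1"
  have "0 < b" using \<open>0 < B\<close> by (simp add: b_def add_nonneg_pos)
  have ub: "\<bar>u \<bullet> x\<bar> < b" if "x \<in> X" for x
    using Cauchy_Schwarz_ineq2[of u x] mult_left_mono[OF B[OF that], of "norm u"]
    by (simp add: b_def)
  have "uniformly_continuous_on {-b..b} h"
    using assms(2) by (intro compact_uniformly_continuous) (auto intro: continuous_on_subset)
  then obtain d where "0 < d" and d: "\<And>s t. s \<in> {-b..b} \<Longrightarrow> t \<in> {-b..b} \<Longrightarrow> \<bar>s - t\<bar> < d \<Longrightarrow> \<bar>h s - h t\<bar> < e / 2"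
    using \<open>0 < e\<close> unfolding uniformly_continuous_on_def dist_real_def
    by (metis half_gt_zero)
  \<comment> \<open>More than \<open>2 * b / d\<close> cells make the grid step \<open>s\<close>
    smaller than \<open>d\<close>.\<close>
  obtain n where n: "2 * b / d < real n" using reals_Archimedean2 by blast
  have "0 < 2 * b / d" using \<open>0 < b\<close> \<open>0 < d\<close> by simp
  then have "0 < n" using n by (cases n) auto
  define s where "s = 2 * b / n"
  have "0 < s" "s < d" "n * s = 2 * b"
    using n \<open>0 < n\<close> \<open>0 < b\<close> \<open>0 < d\<close> by (auto simp: s_def field_simps)
  define t where "t k = - b + real k * s" for k
  have t_Suc: "t (Suc k) = t k + s" for k by (simp add: t_def algebra_simps)
  have t_mono: "t j \<le> t k" if "j \<le> k" for j k
    using that \<open>0 < s\<close> by (simp add: t_def)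
  have "t n = b" "t 0 = - b" using \<open>n * s = 2 * b\<close> by (simp_all add: t_def)
  \<comment> \<open>Ramp \<open>k\<close> rises linearly from 0 at node \<open>t k\<close> to 1 at
    node \<open>t (Suc k)\<close> and is constant elsewhere.\<close>
  define r where "r k y = (max (y - t k) 0 - max (y - t (Suc k)) 0) / s" for k y
  define f where "f x = h (- b) + (\<Sum>k<n. (h (t (Suc k)) - h (t k)) * r k (u \<bullet> x))" for x
  have "(\<lambda>x. r k (u \<bullet> x)) \<in> relu_networks X (1 + 1)" for k
    using relu_networks_scale[OF relu_networks_add[OF relu_networks_unit[of u "- t k" X]
        relu_networks_scale[OF relu_networks_unit[of u "- t (Suc k)" X], of "-1"]], of "1 / s"]
    by (simp add: r_def)
  then have "(\<lambda>x. \<Sum>k<n. (h (t (Suc k)) - h (t k)) * r k (u \<bullet> x)) \<in> relu_networks X (\<Sum>k<n. 1 + 1)"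
    by (intro relu_networks_sum) auto
  then have net: "f \<in> relu_networks X (0 + (\<Sum>k<n. 1 + 1))"
    unfolding f_def by (intro relu_networks_add relu_networks_const)
  have "\<bar>h (u \<bullet> x) - f x\<bar> < e" if "x \<in> X" for x
  proof -
    define y where "y = u \<bullet> x"
    have y: "- b < y" "y < b" using ub[OF that] by (auto simp: y_def)
    \<comment> \<open>The index of the cell containing \<open>y\<close>; as \<open>- b < y\<close>,
      the floor is nonnegative and \<open>nat\<close> loses nothing.\<close>
    define m where "m = nat \<lfloor>(y + b) / s\<rfloor>"
    have "real m = \<lfloor>(y + b) / s\<rfloor>"
      using y \<open>0 < s\<close> by (simp add: m_def)
    then have "real m \<le> (y + b) / s" "(y + b) / s < real m + 1" by linarith+
    then have tm: "t m \<le> y" "y < t (Suc m)"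
      using \<open>0 < s\<close> by (auto simp: t_def field_simps)
    have "m < n" using tm(1) y(2) \<open>t n = b\<close> t_mono[of n m] by (cases "m < n") auto
    have r1: "r k y = 1" if "k < m" for k
      using t_mono[of "Suc k" m] that tm \<open>0 < s\<close> by (simp add: r_def t_Suc)
    have r0: "r k y = 0" if "m < k" for k
      using t_mono[of "Suc m" k] that tm \<open>0 < s\<close> by (simp add: r_def t_Suc)
    have rm: "0 \<le> r m y" "r m y \<le> 1"
      using tm \<open>0 < s\<close> by (auto simp: r_def t_Suc)
    have "f x = h (t m) + (h (t (Suc m)) - h (t m)) * r m y"
      using sum_unit_steps[OF \<open>m < n\<close>, of "\<lambda>k. r k y" "\<lambda>k. h (t k)"] r1 r0 \<open>t 0 = - b\<close>
      by (simp add: f_def y_def)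
    moreover have "t m \<in> {-b..b}" "t (Suc m) \<in> {-b..b}"
      using t_mono[of 0 m] t_mono[of m n] t_mono[of "Suc m" n] t_mono[of 0 "Suc m"] \<open>m < n\<close>
        \<open>t n = b\<close> \<open>t 0 = - b\<close> by auto
    \<comment> \<open>All three points lie in one closed cell of length \<open>s < d\<close>. Moving
      from \<open>y\<close> to the left node costs less than \<open>e / 2\<close>, and the partial
      increment up to \<open>f x\<close> less than another \<open>e / 2\<close>.\<close>
    then have "\<bar>h y - h (t m)\<bar> < e / 2" "\<bar>h (t (Suc m)) - h (t m)\<bar> < e / 2"
      using y tm \<open>0 < s\<close> \<open>s < d\<close> t_Suc[of m] by (intro d; simp)+
    moreover have "\<bar>(h (t (Suc m)) - h (t m)) * r m y\<bar> \<le> \<bar>h (t (Suc m)) - h (t m)\<bar>"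
      using rm by (simp add: abs_mult mult_left_le)
    ultimately show ?thesis unfolding y_def by linarith
  qed
  then show ?thesis using net by blast
qed

section \<open>Density of sums of exponentials\<close>

inductive_set exp_span :: "(real ^ 'n \<Rightarrow> real) set" where
  exp: "(\<lambda>x. c * exp (u \<bullet> x)) \<in> exp_span"
| add: "f \<in> exp_span \<Longrightarrow> g \<in> exp_span \<Longrightarrow> (\<lambda>x. f x + g x) \<in> exp_span"

text \<open>Multiplying two exponentials adds their exponents, so products of generators are
  generators; an induction on each factor extends this to sums by distributivity.\<close>

lemma exp_span_mult:
  assumes "f \<in> exp_span" "g \<in> exp_span"
  shows "(\<lambda>x. f x * g x) \<in> exp_span"
  using assms(1)
proof (induction rule: exp_span.induct)
  case (exp c u)
  show ?case using assms(2)
  proof (induction rule: exp_span.induct)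
    case (exp c' u')
    show ?case
      using exp_span.exp[of "c * c'" "u + u'"]
      by (simp add: exp_add inner_add_left algebra_simps)
  next
    case (add f g)
    show ?case using exp_span.add[OF add.IH] by (simp add: distrib_left)
  qed
next
  case (add f f')
  show ?case using exp_span.add[OF add.IH] by (simp add: distrib_right)
qed

lemma continuous_on_exp_span: "f \<in> exp_span \<Longrightarrow> continuous_on S f"
  by (induction rule: exp_span.induct) (auto intro!: continuous_intros)

lemma exp_span_dense:
  assumes "compact X" "continuous_on X f" "0 < e"
  shows "\<exists>g\<in>exp_span. \<forall>x\<in>X. \<bar>f x - g x\<bar> < e"
proof -
  interpret function_ring_on exp_span X
  proof
    fix x y :: "real ^ 'n" assume "x \<noteq> y"
    \<comment> \<open>The two sides differ by the squared norm of \<open>x - y\<close>, and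
      \<open>exp\<close> is injective, so the exponential in direction \<open>x - y\<close>
      separates the points.\<close>
    then have "(x - y) \<bullet> x \<noteq> (x - y) \<bullet> y"
      by (metis inner_diff_right inner_eq_zero_iff right_minus_eq)
    then show "\<exists>f\<in>exp_span. f x \<noteq> f y"
      by (intro bexI[OF _ exp_span.exp[of 1 "x - y"]]) simp
  next
    show "(\<lambda>_. c) \<in> exp_span" for c using exp_span.exp[of c 0] by simp
  qed (use assms in \<open>auto intro: exp_span.add exp_span_mult continuous_on_exp_span\<close>)
  show ?thesis using Stone_Weierstrass_basic[OF assms(2,3)] .
qed

text \<open>A generator is a ridge function with profile \<open>\<lambda>t. c * exp t\<close>. The
  tolerance varies in the induction because a sum passes \<open>e / 2\<close> to each
  summand.\<close>

lemma relu_exp_span_approx: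
  fixes X :: "(real ^ 'n) set"
  assumes "f \<in> exp_span" "bounded X" "0 < e"
  shows "\<exists>J. \<exists>g\<in>relu_networks X J. \<forall>x\<in>X. \<bar>f x - g x\<bar> < e"
  using assms(1,3)
proof (induction arbitrary: e rule: exp_span.induct)
  case (exp c u)
  show ?case
    by (rule relu_ridge_approx[OF assms(2) _ exp]) (intro continuous_intros)
next
  case (add f f')
  obtain J g where g: "g \<in> relu_networks X J" "\<forall>x\<in>X. \<bar>f x - g x\<bar> < e / 2"
    using add.IH(1)[of "e / 2"] add.prems by auto
  obtain J' g' where g': "g' \<in> relu_networks X J'" "\<forall>x\<in>X. \<bar>f' x - g' x\<bar> < e / 2"
    using add.IH(2)[of "e / 2"] add.prems by auto
  have "\<bar>f x + f' x - (g x + g' x)\<bar> < e" if "x \<in> X" for x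
    using bspec[OF g(2) that] bspec[OF g'(2) that] by linarith
  then show ?case
    by (intro exI[of _ "J + J'"] bexI[OF _ relu_networks_add[OF g(1) g'(1)]] ballI)
qed

lemma relu_continuous_approx:
  fixes X :: "(real ^ 'n) set"
  assumes "compact X" "continuous_on X f" "0 < e"
  shows "\<exists>J. \<exists>g\<in>relu_networks X J. \<forall>x\<in>X. \<bar>f x - g x\<bar> < e"
proof -
  obtain h where h: "h \<in> exp_span" "\<forall>x\<in>X. \<bar>f x - h x\<bar> < e / 2"
    using exp_span_dense[OF assms(1,2)] \<open>0 < e\<close> half_gt_zero by blast
  obtain J g where g: "g \<in> relu_networks X J" "\<forall>x\<in>X. \<bar>h x - g x\<bar> < e / 2"
    using relu_exp_span_approx[OF h(1) compact_imp_bounded[OF assms(1)]] \<open>0 < e\<close> half_gt_zero by blast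
  have "\<bar>f x - g x\<bar> < e" if "x \<in> X" for x
    using bspec[OF h(2) that] bspec[OF g(2) that] by linarith
  then show ?thesis using g(1) by blast
qed

section \<open>Uniformity over the Lipschitz class\<close>

text \<open>Tents of radius \<open>\<delta>\<close> around a finite net, divided by their sum; the
  sum is positive because every point is within \<open>\<delta>\<close> of the net.\<close>

lemma partition_of_unity_net:
  fixes X :: "'a::metric_space set"
  assumes "compact X" "0 < \<delta>"
  obtains C \<phi> where "finite C" "C \<subseteq> X"
    and "\<And>c. c \<in> C \<Longrightarrow> continuous_on X (\<phi> c)"
    and "\<And>c x. c \<in> C \<Longrightarrow> x \<in> X \<Longrightarrow> 0 \<le> \<phi> c x"
    and "\<And>c x. c \<in> C \<Longrightarrow> x \<in> X \<Longrightarrow> \<delta> \<le> dist c x \<Longrightarrow> \<phi> c x = 0"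
    and "\<And>x. x \<in> X \<Longrightarrow> (\<Sum>c\<in>C. \<phi> c x) = (1::real)"
proof -
  obtain C where C: "finite C" "C \<subseteq> X" "X \<subseteq> (\<Union>c\<in>C. ball c \<delta>)"
  proof (rule compactE_image[OF assms(1), of X "\<lambda>c. ball c \<delta>"])
    show "X \<subseteq> (\<Union>c\<in>X. ball c \<delta>)" using \<open>0 < \<delta>\<close> centre_in_ball by blast
  qed auto
  define b where "b c x = max (\<delta> - dist c x) 0" for c x :: 'a
  have pos: "0 < (\<Sum>c\<in>C. b c x)" if x: "x \<in> X" for x
  proof -
    obtain c where c: "c \<in> C" "dist c x < \<delta>" using C(3) x by auto
    then have "0 < b c x" by (simp add: b_def)
    also have "b c x \<le> (\<Sum>c\<in>C. b c x)"
      using C(1) c(1) by (intro member_le_sum) (auto simp: b_def)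
    finally show ?thesis .
  qed
  have cont: "continuous_on X (b c)" for c
    unfolding b_def by (intro continuous_intros)
  show thesis
  proof (rule that[of C "\<lambda>c x. b c x / (\<Sum>c\<in>C. b c x)"])
    show "continuous_on X (\<lambda>x. b c x / (\<Sum>c\<in>C. b c x))" for c
      using pos by (intro continuous_intros cont) (simp add: less_imp_neq[symmetric])
    show "0 \<le> b c x / (\<Sum>c\<in>C. b c x)" if "x \<in> X" for c x
      using pos[OF that] by (simp add: b_def)
    show "b c x / (\<Sum>c\<in>C. b c x) = 0" if "\<delta> \<le> dist c x" for c x
      using that by (simp add: b_def)
    show "(\<Sum>c\<in>C. b c x / (\<Sum>c\<in>C. b c x)) = 1" if "x \<in> X" for x
      using pos[OF that] by (simp flip: sum_divide_distrib)
  qed (use C in auto)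
qed

text \<open>\<open>J\<close> is fixed before \<open>g\<close>: only finitely many functions, chosen
  independently of \<open>g\<close>, are replaced by networks, and \<open>g\<close> enters through
  output weights and the constant term alone.\<close>

lemma relu_Lip_uniform_approx:
  fixes X :: "(real ^ 'n) set"
  assumes "compact X" "0 < e"
  shows "\<exists>J. \<forall>g\<in>Lip X L. \<exists>f\<in>relu_networks X J. \<forall>x\<in>X. \<bar>g x - f x\<bar> \<le> e"
proof (cases "X = {}")
  case True
  then show ?thesis using relu_networks_const[of 0 X] by auto
next
  case False
  then obtain a where "a \<in> X" by auto
  \<comment> \<open>\<open>L\<close> may be zero or negative; \<open>K\<close> dominates it and can
    be divided by.\<close>
  define K where "K = \<bar>L\<bar> + 1"
  have "0 < K" by (simp add: K_def)
  have Lip: "\<bar>g x - g y\<bar> \<le> K * dist x y" if "g \<in> Lip X L" "x \<in> X" "y \<in> X" for g x y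
  proof -
    have "\<bar>g x - g y\<bar> \<le> L * dist x y" using that by (simp add: Lip_def dist_norm)
    also have "\<dots> \<le> K * dist x y" by (intro mult_right_mono) (auto simp: K_def)
    finally show ?thesis .
  qed
  obtain D' where D': "\<And>x. x \<in> X \<Longrightarrow> dist a x \<le> D'"
    using compact_imp_bounded[OF assms(1)] bounded_any_center[of X a] by blast
  define D where "D = max D' 1"
  have "0 < D" by (simp add: D_def)
  have D: "dist x a \<le> D" if "x \<in> X" for x
    using D'[OF that] by (simp add: D_def dist_commute)
  \<comment> \<open>Makes \<open>K * \<delta> = e / 2\<close>, a bound on the variation of
    \<open>g\<close> within distance \<open>\<delta>\<close>.\<close>
  define \<delta> where "\<delta> = e / (2 * K)"
  have "0 < \<delta>" using \<open>0 < K\<close> \<open>0 < e\<close> by (simp add: \<delta>_def)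
  obtain C \<phi> where C: "finite C" "C \<subseteq> X"
    and cont: "\<And>c. c \<in> C \<Longrightarrow> continuous_on X (\<phi> c)"
    and nonneg: "\<And>c x. c \<in> C \<Longrightarrow> x \<in> X \<Longrightarrow> 0 \<le> \<phi> c x"
    and supp: "\<And>c x. c \<in> C \<Longrightarrow> x \<in> X \<Longrightarrow> \<delta> \<le> dist c x \<Longrightarrow> \<phi> c x = 0"
    and one: "\<And>x. x \<in> X \<Longrightarrow> (\<Sum>c\<in>C. \<phi> c x) = (1::real)"
    by (fact partition_of_unity_net[OF assms(1) \<open>0 < \<delta>\<close>])
  define n where "n = real (card C) + 1"
  have "0 < n" by (simp add: n_def add_nonneg_pos)
  \<comment> \<open>Makes \<open>n * (K * D * \<eta>) = e / 2\<close>: fewer than \<open>n\<close>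
    replacements, each with a coefficient of size at most \<open>K * D\<close>.\<close>
  define \<eta> where "\<eta> = e / (2 * K * D * n)"
  have "0 < \<eta>" using \<open>0 < e\<close> \<open>0 < K\<close> \<open>0 < D\<close> \<open>0 < n\<close> by (simp add: \<eta>_def)
  have "\<forall>c\<in>C. \<exists>J. \<exists>f\<in>relu_networks X J. \<forall>x\<in>X. \<bar>\<phi> c x - f x\<bar> < \<eta>"
    using relu_continuous_approx[OF assms(1) cont \<open>0 < \<eta>\<close>] by blast
  then obtain k \<psi> where \<psi>: "\<And>c. c \<in> C \<Longrightarrow> \<psi> c \<in> relu_networks X (k c)"
      and close: "\<And>c x. c \<in> C \<Longrightarrow> x \<in> X \<Longrightarrow> \<bar>\<phi> c x - \<psi> c x\<bar> < \<eta>"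
    by metis
  have "\<exists>f\<in>relu_networks X (0 + sum k C). \<forall>x\<in>X. \<bar>g x - f x\<bar> \<le> e" if g: "g \<in> Lip X L" for g
  proof (intro bexI ballI)
    \<comment> \<open>The Lipschitz bound controls differences of values, not the values themselves;
      subtracting \<open>g a\<close> keeps the coefficients uniformly bounded over the
      class.\<close>
    show "(\<lambda>x. g a + (\<Sum>c\<in>C. (g c - g a) * \<psi> c x)) \<in> relu_networks X (0 + sum k C)"
      using C(1) \<psi> by (intro relu_networks_add relu_networks_const relu_networks_sum)
    fix x assume x: "x \<in> X"
    \<comment> \<open>As the \<open>\<phi> c\<close> sum to 1, the error splits into that of
      replacing \<open>g x\<close> by nearby net values and that of replacing each
      \<open>\<phi> c\<close> by \<open>\<psi> c\<close>.\<close>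
    have "g x - (g a + (\<Sum>c\<in>C. (g c - g a) * \<psi> c x)) =
        (g x - g a) * (\<Sum>c\<in>C. \<phi> c x) - (\<Sum>c\<in>C. (g c - g a) * \<psi> c x)"
      using one[OF x] by simp
    also have "\<dots> = (\<Sum>c\<in>C. (g x - g c) * \<phi> c x) + (\<Sum>c\<in>C. (g c - g a) * (\<phi> c x - \<psi> c x))"
      by (simp add: sum_distrib_left algebra_simps flip: sum.distrib sum_subtractf)
    finally have split: "g x - (g a + (\<Sum>c\<in>C. (g c - g a) * \<psi> c x)) = \<dots>" .
    \<comment> \<open>Only net points within \<open>\<delta>\<close> of \<open>x\<close> contribute,
      and there \<open>g c\<close> is within \<open>e / 2\<close> of \<open>g x\<close>.\<close>
    have "\<bar>\<Sum>c\<in>C. (g x - g c) * \<phi> c x\<bar> \<le> (\<Sum>c\<in>C. (e / 2) * \<phi> c x)"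
    proof (intro order_trans[OF sum_abs] sum_mono)
      fix c assume c: "c \<in> C"
      show "\<bar>(g x - g c) * \<phi> c x\<bar> \<le> (e / 2) * \<phi> c x"
      proof (cases "dist c x < \<delta>")
        case True
        have "\<bar>g x - g c\<bar> \<le> K * dist x c" using Lip[OF g x] c C(2) by blast
        also have "\<dots> \<le> K * \<delta>" using True \<open>0 < K\<close> by (simp add: dist_commute)
        also have "\<dots> = e / 2" using \<open>0 < K\<close> by (simp add: \<delta>_def)
        finally show ?thesis
          using mult_right_mono[OF _ nonneg[OF c x]] nonneg[OF c x] by (simp only: abs_mult abs_of_nonneg)
      next
        case False
        then show ?thesis using supp[OF c x] by simp
      qed
    qed
    also have "\<dots> = e / 2" by (simp only: sum_distrib_left[symmetric] one[OF x] mult_1_right)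
    finally have 1: "\<bar>\<Sum>c\<in>C. (g x - g c) * \<phi> c x\<bar> \<le> e / 2" .
    have "\<bar>\<Sum>c\<in>C. (g c - g a) * (\<phi> c x - \<psi> c x)\<bar> \<le> (\<Sum>c\<in>C. K * D * \<eta>)"
    proof (intro order_trans[OF sum_abs] sum_mono)
      fix c assume c: "c \<in> C"
      have "\<bar>g c - g a\<bar> \<le> K * dist c a" using Lip[OF g _ \<open>a \<in> X\<close>] c C(2) by blast
      also have "\<dots> \<le> K * D" using D c C(2) \<open>0 < K\<close> by (intro mult_left_mono) auto
      finally show "\<bar>(g c - g a) * (\<phi> c x - \<psi> c x)\<bar> \<le> K * D * \<eta>"
        using close[OF c x] unfolding abs_mult by (intro mult_mono) auto
    qed
    also have "\<dots> = real (card C) * (K * D * \<eta>)" by simp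
    also have "\<dots> \<le> n * (K * D * \<eta>)"
      unfolding n_def using \<open>0 < K\<close> \<open>0 < D\<close> \<open>0 < \<eta>\<close> by (intro mult_right_mono) auto
    also have "\<dots> = e / 2"
      using \<open>0 < K\<close> \<open>0 < D\<close> \<open>0 < n\<close> by (simp add: \<eta>_def)
    finally show "\<bar>g x - (g a + (\<Sum>c\<in>C. (g c - g a) * \<psi> c x))\<bar> \<le> e"
      using 1 split by linarith
  qed
  then show ?thesis by blast
qed

section \<open>From uniform error to the Bellman error\<close>

lemma Lp_norm_le:
  assumes "prob_space \<mu>" "space \<mu> = X" "1 \<le> p" "0 \<le> e" and h: "\<And>x. x \<in> X \<Longrightarrow> \<bar>h x\<bar> \<le> e"
  shows "Lp_norm X \<mu> p h \<le> ennreal e"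
proof (cases "p = \<infinity>")
  case True
  then show ?thesis using h by (auto simp: Lp_norm_def intro!: SUP_least ennreal_leI)
next
  case False
  interpret prob_space \<mu> by fact
  define q where "q = enn2real p"
  \<comment> \<open>\<open>enn2real\<close> sends infinity to 0, so positivity rests on
    \<open>p\<close> being finite here.\<close>
  have "0 < q" using False \<open>1 \<le> p\<close>
    by (cases p) (auto simp: q_def ennreal_le_1 simp flip: ennreal_1)
  define I where "I = (\<integral>\<^sup>+ x. ennreal (\<bar>h x\<bar> powr q) \<partial>\<mu>)"
  have "I \<le> (\<integral>\<^sup>+ x. ennreal (e powr q) \<partial>\<mu>)"
    unfolding I_def using h \<open>0 < q\<close> assms(2)
    by (intro nn_integral_mono ennreal_leI powr_mono2) auto
  \<comment> \<open>The total mass is 1, so the constant integrates to itself.\<close>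
  also have "\<dots> = ennreal (e powr q)" by (simp add: emeasure_space_1)
  finally have I: "I \<le> ennreal (e powr q)" .
  then have "I \<noteq> \<infinity>" by (metis ennreal_neq_top infinity_ennreal_def top.extremum_unique)
  have "enn2real I \<le> e powr q" using I by (simp add: enn2real_leI)
  then have "enn2real I powr (1 / q) \<le> (e powr q) powr (1 / q)"
    using \<open>0 < q\<close> by (intro powr_mono2) auto
  also have "\<dots> = e" using \<open>0 < q\<close> \<open>0 \<le> e\<close> by (simp add: powr_powr)
  finally show ?thesis
    using False \<open>I \<noteq> \<infinity>\<close> by (simp add: Lp_norm_def Let_def ennreal_leI flip: q_def I_def)
qed

theorem lemma1:
  fixes X :: "(real ^ 'n) set" and \<mu> :: "(real ^ 'n) measure" and L :: real and p :: ennreal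
  assumes "closed X" and "bounded X"
    and "prob_space \<mu>" and "sets \<mu> = sets (restrict_space borel X)"
    and "1 \<le> p"
  shows "universal X \<mu> p L (relu_networks X)"
proof -
  have "compact X" using assms by (simp add: compact_eq_bounded_closed)
  have "space \<mu> = X" using sets_eq_imp_space_eq[OF assms(4)] by (simp add: space_restrict_space)
  have "\<forall>\<^sub>F J in sequentially. inherent_bellman_error X \<mu> p (Lip X L) (relu_networks X J) < a"
    if "0 < a" for a
  proof -
    \<comment> \<open>Lying below \<open>a\<close> makes \<open>b\<close> finite even for infinite
      \<open>a\<close>, hence a real tolerance; the gap to \<open>a\<close> gives a strict
      inequality after the supremum, which only yields \<open>\<le> b\<close>.\<close>
    obtain b where "0 < b" "b < a" using dense[OF \<open>0 < a\<close>] by blast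
    then obtain e where e: "b = ennreal e" "0 < e"
      by (cases b) (auto simp: ennreal_less_zero_iff)
    obtain N where N: "\<forall>g\<in>Lip X L. \<exists>f\<in>relu_networks X N. \<forall>x\<in>X. \<bar>g x - f x\<bar> \<le> e"
      using relu_Lip_uniform_approx[OF \<open>compact X\<close> e(2)] by blast
    have "inherent_bellman_error X \<mu> p (Lip X L) (relu_networks X J) \<le> b" if "N \<le> J" for J
      unfolding inherent_bellman_error_def
    proof (rule SUP_least)
      fix g assume "g \<in> Lip X L"
      then obtain f where f: "f \<in> relu_networks X N" "\<And>x. x \<in> X \<Longrightarrow> \<bar>g x - f x\<bar> \<le> e"
        using N by blast
      show "(INF f\<in>relu_networks X J. Lp_norm X \<mu> p (\<lambda>x. g x - f x)) \<le> b"
      proof (rule INF_lower2)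
        show "f \<in> relu_networks X J" using relu_networks_mono[OF that] f(1) by blast
        show "Lp_norm X \<mu> p (\<lambda>x. g x - f x) \<le> b"
          unfolding e(1) using assms \<open>space \<mu> = X\<close> e(2) f(2) by (intro Lp_norm_le) auto
      qed
    qed
    then show ?thesis
      using \<open>b < a\<close> by (auto simp: eventually_sequentially intro: le_less_trans)
  qed
  then show ?thesis
    unfolding universal_def by (intro order_tendstoI) auto
qed

end
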